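(* Let $T$ be a triangle (regarded as the set of its three vertices). (1) If $T$ is equilateral, then $S_{T}'(n)\geq\Omega(n^{\log 102/\log 15})\geq\Omega(n^{1.707})$. (2) If $T$ is isosceles, then $S_{T}'(n)\geq\Omega(n^{\log 17/\log 8})\geq\Omega(n^{1.362})$. (3) If $T$ is scalene, then $S_{T}'(n)\geq\Omega(n^{\log 9/\log 5})\geq\Omega(n^{1.365})$; moreover, for almost every scalene triangle $T$ (namely, writing $T$ up to similarity as $\{0,1,z\}$, for all $z\in\mathbb{C}\setminus\mathbb{R}$ outside an exceptional set of Lebesgue measure zero), $S_{T}'(n)\geq\Omega(n^{\log 40/\log 14})\geq\Omega(n^{1.397})$.
   Context: Identify the plane with $\mathbb{C}$. Sets $A,B$ are similar if $B=zA+w$ for some $z,w\in\mathbb{C}$, $z\neq0$. $S_P(Q)$ is the number of subsets of $Q$ similar to $P$. $S'_P(n)$ is the maximum of $S_P(Q)$ over all $n$-point sets $Q\subseteq\mathbb{C}$ in general position, i.e. with no three collinear points. *)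

theory Defs
  imports "HOL-Analysis.Analysis" "HOL-Library.Landau_Symbols"
begin

definition similar_sets :: "complex set \<Rightarrow> complex set \<Rightarrow> bool" where
  "similar_sets A B \<longleftrightarrow> (\<exists>z w. z \<noteq> 0 \<and> B = (\<lambda>a. z * a + w) ` A)"

definition similar_copies :: "complex set \<Rightarrow> complex set \<Rightarrow> nat" where
  "similar_copies P Q = card {B. B \<subseteq> Q \<and> similar_sets P B}"

definition general_position :: "complex set \<Rightarrow> bool" where
  "general_position Q \<longleftrightarrow>
     (\<forall>a\<in>Q. \<forall>b\<in>Q. \<forall>c\<in>Q. a \<noteq> b \<and> b \<noteq> c \<and> a \<noteq> c \<longrightarrow> \<not> collinear {a, b, c})"

text \<open>The values below are bounded by \<open>2 ^ n\<close>, and \<open>n\<close>-point sets in general position exist for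
  every \<open>n\<close>, so \<open>Max\<close> is applied to a finite nonempty set.\<close>

definition max_similar_copies_gp :: "complex set \<Rightarrow> nat \<Rightarrow> nat" where
  "max_similar_copies_gp P n =
     Max {similar_copies P Q | Q. finite Q \<and> card Q = n \<and> general_position Q}"

definition triangle :: "complex set \<Rightarrow> bool" where
  "triangle T \<longleftrightarrow> card T = 3 \<and> \<not> collinear T"

definition equilateral :: "complex set \<Rightarrow> bool" where
  "equilateral T \<longleftrightarrow> triangle T \<and>
     (\<exists>a b c. T = {a, b, c} \<and> dist a b = dist b c \<and> dist b c = dist c a)"

text \<open>At least two equal sides; equilateral triangles are included.\<close>

definition isosceles :: "complex set \<Rightarrow> bool" where
  "isosceles T \<longleftrightarrow> triangle T \<and> (\<exists>a b c. T = {a, b, c} \<and> dist a b = dist a c)"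

definition scalene :: "complex set \<Rightarrow> bool" where
  "scalene T \<longleftrightarrow> triangle T \<and>
     (\<exists>a b c. T = {a, b, c} \<and>
        dist a b \<noteq> dist b c \<and> dist b c \<noteq> dist c a \<and> dist a b \<noteq> dist c a)"

end

theory Submission imports Defs begin

text \<open>If \<open>T\<close> is similar to \<open>{0, 1, z}\<close>, the copies of \<open>T\<close> in \<open>Q\<close> correspond, up to
  degenerate ones and a factor at most 6, to the pairs \<open>(a, b)\<close> in \<open>Q \<times> Q\<close> with
  \<open>(1 - z) a + z b \<in> Q\<close>. As this relation is linear, the number of such pairs is
  at least multiplicative for \<open>A + l B\<close>, where \<open>l\<close> is generic; and generically \<open>A + l B\<close> is again in general
  position and has \<open>card A * card B\<close> points. Hence one seed in general position with \<open>N\<close> points and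
  \<open>M > N\<close> such pairs gives \<open>S'(n) \<ge> \<Omega>(n powr (ln M / ln N))\<close>.

  Seeds: 15 points with 102 pairs in the triangular lattice for equilateral \<open>T\<close>, two different
  8-point sets with 17 pairs for isosceles \<open>T\<close>, which together fail only for the apex angles 60, 90
  and 120 degrees (where lattice sets do better), and 5 points with 9 pairs for scalene \<open>T\<close>.
  For scalene \<open>T\<close> without a right angle there is a centrally symmetric 8-point set with 20 pairs;
  its exponent \<open>ln 20 / ln 8\<close> exceeds \<open>ln 40 / ln 14\<close>, so the exceptional set
  can be taken to consist of the \<open>z\<close> for which \<open>{0, 1, z}\<close> has a right angle.\<close>

section \<open>Amplification of a seed\<close>

text \<open>Twice the signed area of the triangle \<open>a b c\<close>, or
  \<open>Im (cnj (b - a) * (c - a))\<close>. Being polynomial in the coordinates, it can be computed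
  for seeds that depend on a parameter.\<close>

definition orient :: "complex \<Rightarrow> complex \<Rightarrow> complex \<Rightarrow> real" where
  "orient a b c = (Re b - Re a) * (Im c - Im a) - (Im b - Im a) * (Re c - Re a)"

text \<open>After translation by \<open>a\<close>, collinearity says that \<open>c - a\<close> is a
  real multiple of \<open>b - a\<close>. For \<open>a = b\<close> the quotient is 0 by convention,
  which agrees with a degenerate triple being collinear.\<close>

lemma collinear_iff_Im: "collinear {a, b, c} \<longleftrightarrow> Im ((c - a) / (b - a)) = 0"
proof -
  have "collinear {a, b, c} \<longleftrightarrow> collinear {0, b - a, c - a}"
    using collinear_3[of b a c] by (simp only: insert_commute[of a b] NO_MATCH_def)
  then show ?thesis
    by (simp add: collinear_iff_Reals complex_is_Real_iff)
qed

lemma collinear_iff_orient: "collinear {a, b, c} \<longleftrightarrow> orient a b c = 0"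
proof (cases "a = b")
  case False
  then have "(Re b - Re a)\<^sup>2 + (Im b - Im a)\<^sup>2 \<noteq> 0"
    by (auto simp: sum_power2_eq_zero_iff complex_eq_iff)
  then show ?thesis
    using False by (auto simp: collinear_iff_Im Im_divide orient_def algebra_simps complex_eq_iff)
qed (simp add: orient_def)

lemma general_position_iff_orient:
  "general_position Q \<longleftrightarrow>
    (\<forall>a\<in>Q. \<forall>b\<in>Q. \<forall>c\<in>Q. a \<noteq> b \<and> b \<noteq> c \<and> a \<noteq> c \<longrightarrow> orient a b c \<noteq> 0)"
  by (simp add: general_position_def collinear_iff_orient)

lemma orient_swap: "orient b a c = - orient a b c" "orient a c b = - orient a b c"
  by (auto simp: orient_def algebra_simps)

lemma orient_degenerate [simp]: "orient a a c = 0" "orient a b a = 0" "orient a b b = 0"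
  by (auto simp: orient_def algebra_simps)

text \<open>The map \<open>u \<mapsto> (b - a) * u + a\<close> sends 0, 1, \<open>z\<close> to
  \<open>a\<close>, \<open>b\<close> and the third point. Diagonal pairs are kept because in a
  product a diagonal pair of one factor and a proper pair of the other combine to a proper
  copy.\<close>

definition copy_pairs :: "complex \<Rightarrow> complex set \<Rightarrow> (complex \<times> complex) set" where
  "copy_pairs z Q = {(a, b). a \<in> Q \<and> b \<in> Q \<and> (1 - z) * a + z * b \<in> Q}"

lemma finite_copy_pairs [simp]: "finite Q \<Longrightarrow> finite (copy_pairs z Q)"
  by (rule finite_subset[of _ "Q \<times> Q"]) (auto simp: copy_pairs_def)

text \<open>The diagonal contributes \<open>card Q\<close> pairs. Every other pair spans a copy of
  \<open>T\<close>, and a set of at most three points has at most six ordered pairs of distinct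
  elements.\<close>

lemma similar_copies_ge:
  assumes Q: "finite Q" and T: "similar_sets T {0, 1, z}"
  shows "card (copy_pairs z Q) \<le> card Q + 6 * similar_copies T Q"
proof -
  define F where "F = (\<lambda>(a, b). {a, b, (1 - z) * a + z * b})"
  define D where "D = {p \<in> copy_pairs z Q. fst p \<noteq> snd p}"
  define S where "S = {B. B \<subseteq> Q \<and> similar_sets T B}"
  have finS: "finite S" using Q by (auto simp: S_def)
  obtain \<alpha> \<beta> where ab: "\<alpha> \<noteq> 0" "{0, 1, z} = (\<lambda>a. \<alpha> * a + \<beta>) ` T"
    using T by (auto simp: similar_sets_def)
  have sim: "similar_sets T {a, b, (1 - z) * a + z * b}" if "a \<noteq> b" for a b
  proof -
    have "{a, b, (1 - z) * a + z * b} = (\<lambda>u. (b - a) * u + a) ` {0, 1, z}"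
      by (auto simp: algebra_simps)
    also have "\<dots> = (\<lambda>u. ((b - a) * \<alpha>) * u + ((b - a) * \<beta> + a)) ` T"
      by (simp only: ab image_image) (simp add: algebra_simps)
    finally have "{a, b, (1 - z) * a + z * b}
      = (\<lambda>u. ((b - a) * \<alpha>) * u + ((b - a) * \<beta> + a)) ` T" .
    moreover have "(b - a) * \<alpha> \<noteq> 0" using that ab(1) by simp
    ultimately show ?thesis unfolding similar_sets_def by blast
  qed
  have finD: "finite D" using Q by (auto simp: D_def)
  have FS: "F ` D \<subseteq> S"
    using sim by (auto simp: F_def D_def S_def copy_pairs_def)
  have fib: "card {p \<in> D. F p = B} \<le> 6" for B
  proof (cases "\<exists>p\<in>D. F p = B")
    case True
    then have B: "finite B" "card B \<le> 3"
      by (auto simp: F_def card_insert_if)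
    have sub: "{p \<in> D. F p = B} \<subseteq> B \<times> B - Id_on B"
      by (auto simp: D_def F_def)
    have "card (B \<times> B - Id_on B) = card B * card B - card B"
    proof -
      have "Id_on B = (\<lambda>x. (x, x)) ` B" by auto
      then have "card (Id_on B) = card B" by (simp add: card_image inj_on_def)
      moreover have "Id_on B \<subseteq> B \<times> B" by auto
      ultimately show ?thesis using B
        by (simp add: card_Diff_subset finite_subset[of "Id_on B" "B \<times> B"])
    qed
    also have "\<dots> \<le> 6"
    proof -
      have "card B = 0 \<or> card B = 1 \<or> card B = 2 \<or> card B = 3" using B by linarith
      then show ?thesis by auto
    qed
    finally show ?thesis
      using card_mono[OF _ sub] B by (meson finite_Diff finite_SigmaI le_trans)
  next
    case False
    then have "{p \<in> D. F p = B} = {}" by blast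
    then show ?thesis by (simp only: card.empty)
  qed
  have "card D = (\<Sum>B\<in>F ` D. card {p \<in> D. F p = B})"
    using sum.image_gen[OF finD, of "\<lambda>_. 1::nat" F] by simp
  also have "\<dots> \<le> (\<Sum>B\<in>F ` D. 6)" by (intro sum_mono fib)
  also have "\<dots> \<le> 6 * card S" using card_mono[OF finS FS] by simp
  finally have D: "card D \<le> 6 * card S" .
  have "copy_pairs z Q \<subseteq> D \<union> (\<lambda>a. (a, a)) ` Q"
    by (auto simp: D_def copy_pairs_def)
  then have "card (copy_pairs z Q) \<le> card (D \<union> (\<lambda>a. (a, a)) ` Q)"
    using Q finD by (intro card_mono) auto
  also have "\<dots> \<le> card D + card ((\<lambda>a. (a, a)) ` Q)" by (rule card_Un_le)
  also have "\<dots> \<le> card D + card Q" using Q card_image_le by auto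
  finally show ?thesis using D by (simp add: similar_copies_def S_def)
qed

lemma similar_copies_mono:
  assumes "P \<subseteq> Q" "finite Q"
  shows "similar_copies T P \<le> similar_copies T Q"
  unfolding similar_copies_def using assms by (intro card_mono) auto

lemma similar_copies_le_max:
  assumes "finite Q" "card Q = n" "general_position Q"
  shows "similar_copies T Q \<le> max_similar_copies_gp T n"
proof -
  have "similar_copies T P \<le> 2 ^ card P" if "finite P" for P
  proof -
    have "similar_copies T P \<le> card (Pow P)"
      unfolding similar_copies_def using that by (intro card_mono) auto
    then show ?thesis using that by (simp add: card_Pow)
  qed
  then have "{similar_copies T Q | Q. finite Q \<and> card Q = n \<and> general_position Q} \<subseteq> {..2 ^ n}"
    by auto
  then have "finite {similar_copies T Q | Q. finite Q \<and> card Q = n \<and> general_position Q}"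
    using finite_subset by blast
  then show ?thesis
    unfolding max_similar_copies_gp_def using assms by (intro Max_ge) auto
qed

section \<open>Finitely many exceptional parameters\<close>

lemma finite_quartic_roots:
  fixes a b c d e :: real
  assumes "a \<noteq> 0 \<or> b \<noteq> 0 \<or> c \<noteq> 0 \<or> d \<noteq> 0 \<or> e \<noteq> 0"
  shows "finite {t. a + b * t + c * t ^ 2 + d * t ^ 3 + e * t ^ 4 = 0}"
proof -
  have "finite {t. poly [:a, b, c, d, e:] t = 0}"
    using assms by (intro poly_roots_finite) auto
  moreover have "poly [:a, b, c, d, e:] t = a + b * t + c * t ^ 2 + d * t ^ 3 + e * t ^ 4" for t
    by (simp add: algebra_simps power2_eq_square power3_eq_cube power4_eq_xxxx)
  ultimately show ?thesis by (simp only:)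
qed

text \<open>A line meets the parabola in at most two points, so some point of the parabola avoids all
  lines spanned by a finite set.\<close>

lemma general_position_insert:
  assumes "finite Q" "general_position Q"
  obtains p where "p \<notin> Q" "general_position (insert p Q)"
proof -
  define bad where "bad = (\<lambda>(a, b). {t. orient a b (Complex t (t\<^sup>2)) = 0})"
  have "finite (bad (a, b))" if "a \<noteq> b" for a b
  proof -
    \<comment> \<open>The coefficients of \<open>t\<close> and \<open>t^2\<close> are, up to sign,
      the coordinates of \<open>b - a\<close>, so they do not both vanish.\<close>
    have "finite {t. orient a b 0 + - (Im b - Im a) * t + (Re b - Re a) * t ^ 2
        + 0 * t ^ 3 + 0 * t ^ 4 = 0}"
      using that by (intro finite_quartic_roots) (auto simp: complex_eq_iff)
    then show ?thesis
      by (simp add: bad_def orient_def algebra_simps)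
  qed
  \<comment> \<open>Avoiding the real parts of \<open>Q\<close> as well makes the chosen point
    new.\<close>
  then have "finite (Re ` Q \<union> (\<Union>p\<in>{p\<in>Q \<times> Q. fst p \<noteq> snd p}. bad p))"
    using assms(1) by (auto)
  then obtain t where t: "t \<notin> Re ` Q \<union> (\<Union>p\<in>{p\<in>Q \<times> Q. fst p \<noteq> snd p}. bad p)"
    using ex_new_if_finite infinite_UNIV_char_0 by blast
  define p where "p = Complex t (t\<^sup>2)"
  have "p \<notin> Q" using t by (force simp: p_def)
  have or: "orient a b p \<noteq> 0" if "a \<in> Q" "b \<in> Q" "a \<noteq> b" for a b
    using t that by (auto simp: bad_def p_def)
  have "general_position (insert p Q)"
    using assms(2) or unfolding general_position_iff_orient
    by (auto simp: orient_swap(2)[of _ p] orient_swap(1)[of p])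
  then show ?thesis using that \<open>p \<notin> Q\<close> by blast
qed

text \<open>Fills the gaps between the sizes \<open>N ^ k\<close> of the powers of a seed.\<close>

lemma general_position_extend:
  assumes "finite Q" "general_position Q" "card Q \<le> n"
  obtains R where "Q \<subseteq> R" "finite R" "general_position R" "card R = n"
proof -
  have "\<exists>R. Q \<subseteq> R \<and> finite R \<and> general_position R \<and> card R = card Q + k" for k
  proof (induction k)
    case 0
    then show ?case using assms by auto
  next
    case (Suc k)
    then obtain R where R: "Q \<subseteq> R" "finite R" "general_position R" "card R = card Q + k" by blast
    obtain p where "p \<notin> R" "general_position (insert p R)"
      using general_position_insert R by blast
    then show ?case using R by (intro exI[of _ "insert p R"]) auto
  qed
  from this[of "n - card Q"] show ?thesis using that assms(3) by auto
qed

text \<open>The quantity below is a polynomial in \<open>t\<close> along the curve \<open>l = t + \<i> t\<^sup>2\<close>, chosen so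
  that the real and the imaginary part of the coefficient of \<open>l\<close> end up at different powers.\<close>

lemma finite_collinear_projections:
  assumes A: "general_position A" and B: "general_position B"
    and "a1 \<in> A" "a2 \<in> A" "a3 \<in> A" "b1 \<in> B" "b2 \<in> B" "b3 \<in> B"
    and ne: "(a1, b1) \<noteq> (a2, b2)" "(a2, b2) \<noteq> (a3, b3)" "(a1, b1) \<noteq> (a3, b3)"
  shows "finite {t. orient (a1 + Complex t (t\<^sup>2) * b1) (a2 + Complex t (t\<^sup>2) * b2)
    (a3 + Complex t (t\<^sup>2) * b3) = 0}"
proof -
  \<comment> \<open>Expanding \<open>Im (cnj p * q)\<close> for the two difference vectors gives
    \<open>orient a1 a2 a3 + Im (l * w)\<close> plus the squared modulus of \<open>l\<close> times
    \<open>orient b1 b2 b3\<close>. For \<open>l = t + \<i> t^2\<close> the middle term is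
    \<open>Im w * t + Re w * t^2\<close> and the squared modulus is
    \<open>t^2 + t^4\<close>.\<close>
  define w where "w = cnj (a2 - a1) * (b3 - b1) - (b2 - b1) * cnj (a3 - a1)"
  have eq: "orient (a1 + Complex t (t\<^sup>2) * b1) (a2 + Complex t (t\<^sup>2) * b2) (a3 + Complex t (t\<^sup>2) * b3)
     = orient a1 a2 a3 + Im w * t + (Re w + orient b1 b2 b3) * t ^ 2 + 0 * t ^ 3
        + orient b1 b2 b3 * t ^ 4" for t
    by (simp add: orient_def w_def algebra_simps power2_eq_square power4_eq_xxxx)
  have "orient a1 a2 a3 \<noteq> 0 \<or> w \<noteq> 0 \<or> orient b1 b2 b3 \<noteq> 0"
  proof (rule ccontr)
    assume "\<not> ?thesis"
    then have w: "w = 0" and "orient a1 a2 a3 = 0" "orient b1 b2 b3 = 0" by auto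
    then have a: "a1 = a2 \<or> a2 = a3 \<or> a1 = a3" and b: "b1 = b2 \<or> b2 = b3 \<or> b1 = b3"
      using A B assms unfolding general_position_iff_orient by metis+
    from w have w': "cnj (a2 - a1) * (b3 - b1) = (b2 - b1) * cnj (a3 - a1)"
      by (simp add: w_def)
    \<comment> \<open>Where two of the \<open>a\<close> coincide, the corresponding \<open>b\<close>
      differ, so \<open>w = 0\<close> forces the third \<open>a\<close> to coincide too. Then the
      three \<open>b\<close> are distinct, contrary to \<open>b\<close>.\<close>
    show False
      using a
    proof (elim disjE)
      assume "a1 = a2"
      then show False using w' ne b by auto
    next
      assume "a1 = a3"
      then show False using w' ne b by auto
    next
      assume "a2 = a3"
      then show False using w' ne b by (cases "a1 = a2") auto
    qed
  qed
  then show ?thesis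
    unfolding eq by (intro finite_quartic_roots) (auto simp: complex_eq_iff)
qed

text \<open>On the curve \<open>l = t + \<i> t^2\<close>, two distinct points of
  \<open>A \<times> B\<close> are identified for at most one \<open>t\<close>, and three distinct
  points become collinear for finitely many \<open>t\<close>. A parameter outside this finite union
  works.\<close>

lemma ex_generic_projection:
  assumes fin: "finite A" "finite B" and A: "general_position A" and B: "general_position B"
  obtains l where "inj_on (\<lambda>(a, b). a + l * b) (A \<times> B)"
    "general_position ((\<lambda>(a, b). a + l * b) ` (A \<times> B))"
proof -
  define P where "P = (\<lambda>t (a, b). a + Complex t (t\<^sup>2) * b)"
  define X where "X = A \<times> B"
  define bad2 where "bad2 = (\<lambda>(x, y). {t. P t x = P t y})"
  define bad3 where "bad3 = (\<lambda>(x, y, z). {t. orient (P t x) (P t y) (P t z) = 0})"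
  define Y2 where "Y2 = {(x, y). x \<in> X \<and> y \<in> X \<and> x \<noteq> y}"
  define Y3 where "Y3 = {(x, y, z). x \<in> X \<and> y \<in> X \<and> z \<in> X \<and> x \<noteq> y \<and> y \<noteq> z \<and> x \<noteq> z}"
  have "finite (bad2 p)" if "p \<in> Y2" for p
  proof -
    obtain a b c d where p: "p = ((a, b), (c, d))" by (metis surj_pair)
    show ?thesis
    proof (cases "b = d")
      case True
      then have "bad2 p = {}" using that by (auto simp: p bad2_def P_def Y2_def)
      then show ?thesis by simp
    next
      case False
      have "bad2 p \<subseteq> {Re ((c - a) / (b - d))}"
      proof
        fix t assume "t \<in> bad2 p"
        then have "Complex t (t\<^sup>2) * (b - d) = c - a"
          by (simp add: p bad2_def P_def algebra_simps)
        then have "(c - a) / (b - d) = Complex t (t\<^sup>2)"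
          using False by (metis nonzero_mult_div_cancel_right right_minus_eq)
        then show "t \<in> {Re ((c - a) / (b - d))}" by simp
      qed
      then show ?thesis using finite_subset by blast
    qed
  qed
  moreover have "finite (bad3 p)" if "p \<in> Y3" for p
  proof -
    obtain a1 b1 a2 b2 a3 b3 where p: "p = ((a1, b1), (a2, b2), (a3, b3))" by (metis surj_pair)
    have "finite (bad3 ((a1, b1), (a2, b2), (a3, b3)))"
      unfolding bad3_def P_def prod.case
      by (rule finite_collinear_projections[OF A B]) (use that in \<open>auto simp: p Y3_def X_def\<close>)
    then show ?thesis by (simp add: p)
  qed
  moreover have "finite Y2" "finite Y3"
  proof -
    have "finite X" using fin by (simp add: X_def)
    then show "finite Y2" "finite Y3"
      by (auto intro: finite_subset[of _ "X \<times> X"] finite_subset[of _ "X \<times> X \<times> X"] simp: Y2_def Y3_def)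
  qed
  ultimately have "finite ((\<Union>p\<in>Y2. bad2 p) \<union> (\<Union>p\<in>Y3. bad3 p))" by blast
  then obtain t where t: "t \<notin> (\<Union>p\<in>Y2. bad2 p) \<union> (\<Union>p\<in>Y3. bad3 p)"
    using ex_new_if_finite infinite_UNIV_char_0 by blast
  have "inj_on (P t) X"
    using t by (force simp: inj_on_def bad2_def Y2_def)
  moreover have "general_position (P t ` X)"
    unfolding general_position_iff_orient
  proof (intro ballI impI)
    fix a b c assume "a \<in> P t ` X" "b \<in> P t ` X" "c \<in> P t ` X" and ne: "a \<noteq> b \<and> b \<noteq> c \<and> a \<noteq> c"
    then obtain x y z where x: "x \<in> X" "y \<in> X" "z \<in> X" "a = P t x" "b = P t y" "c = P t z"
      by auto
    then have "(x, y, z) \<in> Y3" using ne by (auto simp: Y3_def)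
    then show "orient a b c \<noteq> 0" using t x by (auto simp: bad3_def)
  qed
  ultimately show ?thesis using that by (simp add: P_def X_def)
qed

text \<open>The map \<open>(a, b) \<mapsto> a + l * b\<close> is linear, so it commutes with forming
  \<open>(1 - z) * x + z * y\<close>. A pair from \<open>A\<close> and a pair from \<open>B\<close>
  thus combine to a pair in \<open>C\<close>, injectively because the projection is
  injective.\<close>

lemma product_general_position:
  assumes fin: "finite A" "finite B" and "general_position A" "general_position B"
  obtains C where "finite C" "general_position C" "card C = card A * card B"
    "card (copy_pairs z A) * card (copy_pairs z B) \<le> card (copy_pairs z C)"
proof -
  obtain l where inj: "inj_on (\<lambda>(a, b). a + l * b) (A \<times> B)"
    and gp: "general_position ((\<lambda>(a, b). a + l * b) ` (A \<times> B))"
    using ex_generic_projection assms by blast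
  define C where "C = (\<lambda>(a, b). a + l * b) ` (A \<times> B)"
  define g where "g = (\<lambda>((a, a'), (b, b')). (a + l * b, a' + l * b'))"
  have "finite C" "card C = card A * card B"
    using fin card_image[OF inj] by (auto simp: C_def card_cartesian_product)
  moreover have "inj_on g (copy_pairs z A \<times> copy_pairs z B)"
  proof (rule inj_onI)
    fix p q assume p: "p \<in> copy_pairs z A \<times> copy_pairs z B" and q: "q \<in> copy_pairs z A \<times> copy_pairs z B"
      and eq: "g p = g q"
    obtain a a' b b' c c' d d' where pq: "p = ((a, a'), (b, b'))" "q = ((c, c'), (d, d'))"
      by (metis surj_pair)
    show "p = q"
      using p q eq inj_onD[OF inj, of "(a, b)" "(c, d)"] inj_onD[OF inj, of "(a', b')" "(c', d')"]
      by (auto simp: pq g_def copy_pairs_def)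
  qed
  moreover have "g ` (copy_pairs z A \<times> copy_pairs z B) \<subseteq> copy_pairs z C"
  proof clarify
    fix a a' b b' x y
    assume *: "(a, a') \<in> copy_pairs z A" "(b, b') \<in> copy_pairs z B"
      and "(x, y) = g ((a, a'), (b, b'))"
    then have xy: "x = a + l * b" "y = a' + l * b'" by (auto simp: g_def)
    have "(1 - z) * x + z * y = ((1 - z) * a + z * a') + l * ((1 - z) * b + z * b')"
      by (simp add: xy algebra_simps)
    then show "(x, y) \<in> copy_pairs z C"
      using * unfolding copy_pairs_def C_def xy by (auto intro: rev_image_eqI)
  qed
  ultimately have "card (copy_pairs z A \<times> copy_pairs z B) \<le> card (copy_pairs z C)"
    by (metis card_image card_mono finite_copy_pairs)
  then show ?thesis
    using that gp \<open>finite C\<close> \<open>card C = _\<close> by (simp add: C_def card_cartesian_product)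
qed

lemma power_general_position:
  assumes "finite A" "general_position A" "card A = N" "M \<le> card (copy_pairs z A)"
  obtains C where "finite C" "general_position C" "card C = N ^ k" "M ^ k \<le> card (copy_pairs z C)"
proof -
  have "\<exists>C. finite C \<and> general_position C \<and> card C = N ^ k \<and> M ^ k \<le> card (copy_pairs z C)"
  proof (induction k)
    case 0
    have "copy_pairs z {0} = {(0, 0)}" by (auto simp: copy_pairs_def)
    then show ?case by (intro exI[of _ "{0}"]) (auto simp: general_position_def)
  next
    case (Suc k)
    then obtain C where C: "finite C" "general_position C" "card C = N ^ k"
      "M ^ k \<le> card (copy_pairs z C)" by blast
    obtain D where D: "finite D" "general_position D" "card D = card A * card C"
      "card (copy_pairs z A) * card (copy_pairs z C) \<le> card (copy_pairs z D)"
      using product_general_position[of A C z] assms C by blast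
    have "M * M ^ k \<le> card (copy_pairs z A) * card (copy_pairs z C)"
      using assms C by (intro mult_mono) auto
    then show ?case using D C assms by (intro exI[of _ D]) auto
  qed
  then show ?thesis using that by blast
qed

text \<open>For \<open>N ^ k \<le> n < N ^ (k + 1)\<close>, extend the \<open>k\<close>-th power of
  the seed to \<open>n\<close> points. It has at least \<open>(M ^ k - N ^ k) / 6\<close> copies,
  and this is of order \<open>n powr e\<close> since \<open>N powr e = M\<close> and
  \<open>N < M\<close>.\<close>

theorem seed_lower_bound:
  assumes A: "finite A" "general_position A" "card A = N" "M \<le> card (copy_pairs z A)"
    and N: "2 \<le> N" "N < M" and T: "similar_sets T {0, 1, z}"
  shows "(\<lambda>n. real (max_similar_copies_gp T n)) \<in> \<Omega>(\<lambda>n. real n powr (ln M / ln N))"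
proof -
  define e where "e = ln M / ln N"
  have N1: "1 < real N" "0 < ln (real N)" and M0: "0 < real M" using N by auto
  have e: "e > 0" using N by (auto simp: e_def intro!: divide_pos_pos)
  have NM: "real N powr e = real M" using N1 M0 by (simp add: e_def powr_def)
  \<comment> \<open>The numerator pays for the diagonal pairs, using
    \<open>(N / M) ^ k \<le> N / M\<close> for \<open>k \<ge> 1\<close>. The 6 is the multiplicity
    of a copy, and \<open>M\<close> is lost by bounding \<open>n\<close> by
    \<open>N ^ (k + 1)\<close>.\<close>
  define c where "c = (1 - N / M) / (6 * M)"
  have c: "c > 0" using N by (simp add: c_def)
  have main: "c * (real n powr e) \<le> real (max_similar_copies_gp T n)" if n: "n \<ge> N" for n
  proof -
    obtain k where k: "N ^ k \<le> n" "n < N ^ (k + 1)"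
      using ex_power_ivl1[of N n] N n by auto
    have "k \<noteq> 0"
    proof
      assume "k = 0"
      then show False using k n by simp
    qed
    obtain C where C: "finite C" "general_position C" "card C = N ^ k"
      "M ^ k \<le> card (copy_pairs z C)"
      using power_general_position[OF A] by blast
    obtain R where R: "C \<subseteq> R" "finite R" "general_position R" "card R = n"
      using general_position_extend[of C n] C k by metis
    have "M ^ k \<le> N ^ k + 6 * similar_copies T C"
      using similar_copies_ge[OF C(1) T] C by linarith
    also have "similar_copies T C \<le> similar_copies T R"
      using similar_copies_mono R by blast
    also have "\<dots> \<le> max_similar_copies_gp T n"
      using similar_copies_le_max R by blast
    finally have "real (M ^ k) \<le> real (N ^ k + 6 * max_similar_copies_gp T n)"
      by (simp only: of_nat_le_iff)
    then have 1: "real M ^ k - real N ^ k \<le> 6 * real (max_similar_copies_gp T n)"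
      by simp
    have "real N ^ k / real M ^ k \<le> N / M"
    proof -
      have "(real N / real M) ^ k \<le> (real N / real M) ^ 1"
        using \<open>k \<noteq> 0\<close> N by (intro power_decreasing) auto
      then show ?thesis by (simp add: power_divide)
    qed
    then have 2: "(1 - N / M) * real M ^ k \<le> real M ^ k - real N ^ k"
      using M0 by (simp add: field_simps)
    have "real n powr e \<le> (real N ^ (k + 1)) powr e"
      using k e by (intro powr_mono2) (auto simp flip: of_nat_power of_nat_mult)
    also have "\<dots> = (real N powr e) ^ (k + 1)"
    proof -
      have "real N ^ (k + 1) = real N powr real (k + 1)"
        using N1 by (simp only: powr_realpow)
      then have "(real N ^ (k + 1)) powr e = (real N powr e) powr real (k + 1)"
        by (simp only: powr_powr mult.commute)
      also have "\<dots> = (real N powr e) ^ (k + 1)"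
        using N1 by (intro powr_realpow) auto
      finally show ?thesis .
    qed
    also have "\<dots> = real M * real M ^ k" by (simp add: NM)
    finally have "c * (real n powr e) \<le> c * (real M * real M ^ k)"
      using c by (intro mult_left_mono) auto
    also have "\<dots> = (1 - N / M) * real M ^ k / 6"
      using M0 by (simp add: c_def)
    also have "\<dots> \<le> real (max_similar_copies_gp T n)"
      using order_trans[OF 2 1] by (simp only: pos_divide_le_eq mult.commute zero_less_numeral)
    finally show ?thesis .
  qed
  show ?thesis
    unfolding e_def[symmetric]
  proof (rule landau_omega.bigI[OF c])
    show "\<forall>\<^sub>F n in sequentially. norm (real (max_similar_copies_gp T n)) \<ge> c * norm (real n powr e)"
      using eventually_ge_at_top[of N] by eventually_elim (use main in auto)
  qed
qed

section \<open>Seeds in lattices\<close>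

fun pair_map :: "('a \<Rightarrow> 'a \<Rightarrow> 'b) \<Rightarrow> 'a list \<Rightarrow> 'b list" where
  "pair_map f [] = []"
| "pair_map f (p # ps) = map (f p) ps @ pair_map f ps"

text \<open>Only triples in list order occur, which suffices for \<open>orient\<close> by
  antisymmetry. General position of a seed thus becomes the absence of 0 from one explicit list,
  with 56 entries for 8 points.\<close>

fun triple_map :: "('a \<Rightarrow> 'a \<Rightarrow> 'a \<Rightarrow> 'b) \<Rightarrow> 'a list \<Rightarrow> 'b list" where
  "triple_map f [] = []"
| "triple_map f (p # ps) = pair_map (f p) ps @ triple_map f ps"

lemma pair_map_cong:
  "(\<And>a b. f (h a) (h b) = g (f' a b)) \<Longrightarrow> pair_map f (map h ps) = map g (pair_map f' ps)"
  by (induction ps) auto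

lemma triple_map_cong:
  "(\<And>a b c. f (h a) (h b) (h c) = g (f' a b c)) \<Longrightarrow>
    triple_map f (map h ps) = map g (triple_map f' ps)"
  by (induction ps) (auto intro!: pair_map_cong)

lemma pair_map_orient:
  assumes "0 \<notin> set (pair_map (orient p) ps)" "a \<in> set ps" "b \<in> set ps" "a \<noteq> b"
  shows "orient p a b \<noteq> 0"
  using assms
proof (induction ps)
  case (Cons q qs)
  then have "\<forall>r\<in>set qs. orient p q r \<noteq> 0" by (auto simp: image_iff)
  moreover have "orient p a b = - orient p b a" by (rule orient_swap)
  ultimately show ?case using Cons by auto
qed auto

lemma general_position_triple_map:
  assumes "0 \<notin> set (triple_map orient ps)"
  shows "general_position (set ps)"
  using assms
proof (induction ps)
  case Nil
  then show ?case by (simp add: general_position_def)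
next
  case (Cons p ps)
  then have "general_position (set ps)" "0 \<notin> set (pair_map (orient p) ps)" by auto
  then show ?case
    unfolding general_position_iff_orient
    using pair_map_orient[of p ps]
    by (auto simp: orient_swap(2)[of _ p] orient_swap(1)[of p])
qed

text \<open>A second occurrence of \<open>p\<close> together with any other entry would give a
  determinant 0; the length bound provides that other entry.\<close>

lemma notin_set_if_pair_map_orient:
  assumes "0 \<notin> set (pair_map (orient p) ps)" "length ps \<ge> 2"
  shows "p \<notin> set ps"
  using assms
proof (induction ps)
  case (Cons q qs)
  then obtain r rs where "qs = r # rs" by (cases qs) auto
  then show ?case using Cons by (cases rs) auto
qed auto

lemma distinct_triple_map:
  assumes "0 \<notin> set (triple_map orient ps)" "length ps \<ge> 3"
  shows "distinct ps"
  using assms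
proof (induction ps)
  case (Cons p ps)
  then have p: "p \<notin> set ps" by (intro notin_set_if_pair_map_orient) auto
  show ?case
  proof (cases "length ps \<ge> 3")
    case True
    then show ?thesis using Cons p by auto
  next
    \<comment> \<open>The tail is too short for the induction hypothesis; its two entries differ
      because their determinant with \<open>p\<close> is nonzero.\<close>
    case False
    then obtain q r where "ps = [q, r]" using Cons.prems(2)
      by (cases ps; cases "tl ps"; cases "tl (tl ps)") auto
    then show ?thesis using Cons p by auto
  qed
qed auto

text \<open>An entry \<open>(i, j, k)\<close> of \<open>ts\<close> is an index certificate for one
  off-diagonal pair; the diagonal adds \<open>length ps\<close> pairs.\<close>

lemma card_copy_pairs_list:
  assumes "distinct ps" and "distinct (map (\<lambda>(i, j, k). (i, j)) ts)"
    and ts: "\<forall>(i, j, k) \<in> set ts. i < length ps \<and> j < length ps \<and> k < length ps \<and> i \<noteq> j \<and>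
      ps ! k = (1 - z) * ps ! i + z * ps ! j"
  shows "length ps + length ts \<le> card (copy_pairs z (set ps))"
proof -
  define D where "D = (\<lambda>(i, j, k::nat). (ps ! i, ps ! j)) ` set ts"
  have "card ((\<lambda>(i, j, k). (i, j)) ` set ts) = length ts"
    using distinct_card[OF assms(2)] by simp
  moreover have "D = (\<lambda>(i, j). (ps ! i, ps ! j)) ` (\<lambda>(i, j, k). (i, j)) ` set ts"
    by (force simp: D_def image_image)
  moreover have "inj_on (\<lambda>(i, j). (ps ! i, ps ! j)) ((\<lambda>(i, j, k). (i, j)) ` set ts)"
  proof (rule inj_on_subset)
    show "inj_on (\<lambda>(i, j). (ps ! i, ps ! j)) ({..<length ps} \<times> {..<length ps})"
      using assms(1) by (auto simp: inj_on_def nth_eq_iff_index_eq)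
  qed (use ts in auto)
  ultimately have "card D = length ts" by (metis card_image)
  moreover have "card ((\<lambda>p. (p, p)) ` set ps) = length ps"
    using assms(1) by (simp add: card_image inj_on_def distinct_card)
  moreover have "D \<inter> (\<lambda>p. (p, p)) ` set ps = {}"
  proof -
    have "ps ! i \<noteq> ps ! j" if "(i, j, k) \<in> set ts" for i j k
      using ts that assms(1) by (auto simp: nth_eq_iff_index_eq)
    then show ?thesis by (fastforce simp: D_def)
  qed
  ultimately have "card (D \<union> (\<lambda>p. (p, p)) ` set ps) = length ps + length ts"
    by (subst card_Un_disjoint) (auto simp: D_def)
  moreover have "D \<union> (\<lambda>p. (p, p)) ` set ps \<subseteq> copy_pairs z (set ps)"
  proof -
    have "(ps ! i, ps ! j) \<in> copy_pairs z (set ps)" if "(i, j, k) \<in> set ts" for i j k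
      using ts that by (force simp: copy_pairs_def set_conv_nth)
    then show ?thesis by (auto simp: D_def copy_pairs_def algebra_simps)
  qed
  ultimately show ?thesis
    by (metis List.finite_set card_mono finite_copy_pairs)
qed

lemma list_lower_bound:
  assumes gp: "0 \<notin> set (triple_map orient ps)" and "distinct (map (\<lambda>(i, j, k). (i, j)) ts)"
    and "\<forall>(i, j, k) \<in> set ts. i < length ps \<and> j < length ps \<and> k < length ps \<and> i \<noteq> j \<and>
      ps ! k = (1 - z) * ps ! i + z * ps ! j"
    and N: "N = length ps" "M = length ps + length ts" "3 \<le> length ps" "ts \<noteq> []"
    and T: "similar_sets T {0, 1, z}"
  shows "(\<lambda>n. real (max_similar_copies_gp T n)) \<in> \<Omega>(\<lambda>n. real n powr (ln M / ln N))"
proof (rule seed_lower_bound[OF _ general_position_triple_map[OF gp]])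
  have d: "distinct ps" using distinct_triple_map gp N by blast
  show "card (set ps) = N" using distinct_card[OF d] N by simp
  show "M \<le> card (copy_pairs z (set ps))"
    using card_copy_pairs_list[OF d assms(2,3)] N by simp
qed (use N T in auto)

section \<open>Seeds with integer coordinates\<close>

definition lattice :: "complex \<Rightarrow> int \<times> int \<Rightarrow> complex" where
  "lattice w p = of_int (fst p) + of_int (snd p) * w"

definition int_orient :: "int \<times> int \<Rightarrow> int \<times> int \<Rightarrow> int \<times> int \<Rightarrow> int" where
  "int_orient a b c = (fst b - fst a) * (snd c - snd a) - (snd b - snd a) * (fst c - fst a)"

text \<open>The factor \<open>Im w\<close> is the determinant of the basis 1,
  \<open>w\<close>.\<close>

lemma orient_lattice:
  "orient (lattice w a) (lattice w b) (lattice w c) = Im w * of_int (int_orient a b c)"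
  by (simp add: orient_def lattice_def int_orient_def algebra_simps)

text \<open>If \<open>m\<close> expresses the third point in lattice coordinates, both general
  position and the number of pairs are integer computations. The count \<open>M\<close> includes the
  diagonal.\<close>

lemma lattice_lower_bound:
  assumes w: "Im w \<noteq> 0" and gp: "0 \<notin> set (triple_map int_orient qs)"
    and m: "\<And>p q. lattice w (m p q) = (1 - z) * lattice w p + z * lattice w q"
    and M: "length (filter (\<lambda>(p, q). m p q \<in> set qs) (List.product qs qs)) = M"
    and N: "length qs = N" "3 \<le> N" "N < M"
    and T: "similar_sets T {0, 1, z}"
  shows "(\<lambda>n. real (max_similar_copies_gp T n)) \<in> \<Omega>(\<lambda>n. real n powr (ln M / ln N))"
proof -
  define ps where "ps = map (lattice w) qs"
  have "triple_map orient ps = map (\<lambda>x. Im w * of_int x) (triple_map int_orient qs)"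
    unfolding ps_def by (rule triple_map_cong) (rule orient_lattice)
  then have gp': "0 \<notin> set (triple_map orient ps)" using gp w by auto
  have d: "distinct ps" using distinct_triple_map gp' N by (simp add: ps_def)
  have inj: "inj_on (lattice w) (set qs)" and dq: "distinct qs"
    using d by (auto simp: ps_def distinct_map)
  let ?F = "filter (\<lambda>(p, q). m p q \<in> set qs) (List.product qs qs)"
  have "distinct ?F" using dq by (simp add: distinct_product)
  then have "card (set ?F) = M" using M distinct_card by metis
  moreover have "inj_on (map_prod (lattice w) (lattice w)) (set ?F)"
    by (rule inj_on_subset[OF map_prod_inj_on[OF inj inj]]) auto
  moreover have "map_prod (lattice w) (lattice w) ` set ?F \<subseteq> copy_pairs z (set ps)"
    by (auto simp: copy_pairs_def ps_def m[symmetric])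
  ultimately have "M \<le> card (copy_pairs z (set ps))"
    by (metis List.finite_set card_image card_mono finite_copy_pairs)
  moreover have "card (set ps) = N" using distinct_card[OF d] N by (simp add: ps_def)
  ultimately show ?thesis
    using N by (intro seed_lower_bound[OF _ general_position_triple_map[OF gp'] _ _ _ _ T]) auto
qed

text \<open>Here \<open>z\<close> is a primitive sixth root of unity, and \<open>?m p q\<close> is
  \<open>p + z (q - p)\<close> reduced by \<open>z^2 = z - 1\<close>. Each triangle is counted three
  times, by rotation, so the 102 pairs are 15 diagonal ones and 3 for each of 29 triangles.\<close>

lemma equilateral_lower_bound:
  assumes "z = Complex (1/2) (sqrt 3 / 2)" and T: "similar_sets T {0, 1, z}"
  shows "(\<lambda>n. real (max_similar_copies_gp T n)) \<in> \<Omega>(\<lambda>n. real n powr (ln 102 / ln 15))"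
proof -
  let ?qs = "[(0,0), (1,0), (0,1), (-4,1), (-3,5), (-1,-3), (2,3), (4,-5), (5,-1), (3,-4), (4,-4),
    (1,4), (2,4), (-4,2), (-5,2)] :: (int \<times> int) list"
  let ?m = "\<lambda>p q. (fst p - snd q + snd p, fst q - fst p + snd q)"
  have z2: "z * z = z - 1"
    by (simp add: assms complex_eq_iff)
  have *: "lattice z (?m p q) = (1 - z) * lattice z p + z * lattice z q" for p q
  proof -
    have "lattice z (?m p q) - ((1 - z) * lattice z p + z * lattice z q)
      = (of_int (snd p) - of_int (snd q)) * (z * z - (z - 1))"
      by (simp add: lattice_def algebra_simps)
    then show ?thesis by (simp add: z2)
  qed
  have "(\<lambda>n. real (max_similar_copies_gp T n)) \<in> \<Omega>(\<lambda>n. real n powr (ln (102::nat) / ln (15::nat)))"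
  proof (rule lattice_lower_bound[where w = z and m = ?m and qs = ?qs, OF _ _ * _ _ _ _ T])
    show "0 \<notin> set (triple_map int_orient ?qs)" by code_simp
    show "length (filter (\<lambda>(p, q). ?m p q \<in> set ?qs) (List.product ?qs ?qs)) = 102" by code_simp
  qed (auto simp: assms complex_eq_iff)
  then show ?thesis by simp
qed

text \<open>Apex angle 90 degrees: each corner of the unit square is the apex of one copy, giving 4
  + 4 pairs.\<close>

lemma square_lower_bound:
  assumes T: "similar_sets T {0, 1, \<i>}"
  shows "(\<lambda>n. real (max_similar_copies_gp T n)) \<in> \<Omega>(\<lambda>n. real n powr (ln 8 / ln 4))"
proof -
  let ?qs = "[(0,0), (1,0), (0,1), (1,1)] :: (int \<times> int) list"
  let ?m = "\<lambda>p q. (fst p + snd p - snd q, snd p - fst p + fst q)"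
  have *: "lattice \<i> (?m p q) = (1 - \<i>) * lattice \<i> p + \<i> * lattice \<i> q" for p q
    by (simp add: lattice_def algebra_simps)
  have "(\<lambda>n. real (max_similar_copies_gp T n)) \<in> \<Omega>(\<lambda>n. real n powr (ln (8::nat) / ln (4::nat)))"
  proof (rule lattice_lower_bound[where w = \<i> and m = ?m and qs = ?qs, OF _ _ * _ _ _ _ T])
    show "0 \<notin> set (triple_map int_orient ?qs)" by code_simp
    show "length (filter (\<lambda>(p, q). ?m p q \<in> set ?qs) (List.product ?qs ?qs)) = 8" by code_simp
  qed auto
  then show ?thesis by simp
qed

text \<open>Apex angle 120 degrees: the points form a regular hexagon, and each vertex is the apex
  over its two neighbours, giving 6 + 6 pairs.\<close>

lemma hexagon_lower_bound:
  assumes "z = Complex (-1/2) (sqrt 3 / 2)" and T: "similar_sets T {0, 1, z}"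
  shows "(\<lambda>n. real (max_similar_copies_gp T n)) \<in> \<Omega>(\<lambda>n. real n powr (ln 12 / ln 6))"
proof -
  let ?qs = "[(1,0), (1,1), (0,1), (-1,0), (-1,-1), (0,-1)] :: (int \<times> int) list"
  let ?m = "\<lambda>p q. (fst p + snd p - snd q, 2 * snd p - fst p + fst q - snd q)"
  have z2: "z * z = - z - 1"
    by (simp add: assms complex_eq_iff)
  have *: "lattice z (?m p q) = (1 - z) * lattice z p + z * lattice z q" for p q
  proof -
    have "lattice z (?m p q) - ((1 - z) * lattice z p + z * lattice z q)
      = (of_int (snd p) - of_int (snd q)) * (z * z - (- z - 1))"
      by (simp add: lattice_def algebra_simps)
    then show ?thesis by (simp add: z2)
  qed
  have "(\<lambda>n. real (max_similar_copies_gp T n)) \<in> \<Omega>(\<lambda>n. real n powr (ln (12::nat) / ln (6::nat)))"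
  proof (rule lattice_lower_bound[where w = z and m = ?m and qs = ?qs, OF _ _ * _ _ _ _ T])
    show "0 \<notin> set (triple_map int_orient ?qs)" by code_simp
    show "length (filter (\<lambda>(p, q). ?m p q \<in> set ?qs) (List.product ?qs ?qs)) = 12" by code_simp
  qed (auto simp: assms complex_eq_iff)
  then show ?thesis by simp
qed

section \<open>Seeds depending on the triangle\<close>

lemma sum_squares_pos:
  fixes x y :: real
  assumes "y \<noteq> 0"
  shows "0 < x^2 + y^2"
  using assms by (simp add: add_nonneg_pos)

text \<open>These rewrites expand an equation between lists of determinants into one polynomial
  identity per entry.\<close>

lemmas triple_orient_simps = triple_map.simps pair_map.simps list.map append.simps orient_def
  complex.sel zero_complex.sel one_complex.sel plus_complex.sel minus_complex.sel times_complex.sel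
  complex_Re_numeral complex_Im_numeral list.inject simp_thms

text \<open>The point \<open>z * (1 - z)\<close> completes two copies, so five points carry four
  proper pairs. The excluded factors say that \<open>{0, 1, z}\<close> is isosceles or, for
  \<open>x^2 + y^2 - x\<close>, that it has a right angle at \<open>z\<close>.\<close>

lemma scalene_lower_bound:
  assumes z: "z = Complex x y" and "y \<noteq> 0" "2 * x - 1 \<noteq> 0" "x^2 + y^2 - 1 \<noteq> 0"
    "(x - 1)^2 + y^2 - 1 \<noteq> 0" "x^2 + y^2 - x \<noteq> 0"
    and T: "similar_sets T {0, 1, z}"
  shows "(\<lambda>n. real (max_similar_copies_gp T n)) \<in> \<Omega>(\<lambda>n. real n powr (ln 9 / ln 5))"
proof -
  let ?ps = "[0, 1, z, 1 - z, z * (1 - z)]"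
  let ?ts = "[(0,1,2), (1,0,3), (2,0,4), (0,3,4)] :: (nat \<times> nat \<times> nat) list"
  have eq: "triple_map orient ?ps =
    [
      y, - y, - (y * (2 * x - 1)), - y, - (y * (x^2 + y^2)), y * ((x - 1)^2 + y^2), y,
      - (y * ((x - 1)^2 + y^2 - 1)), y * (x^2 + y^2 - 1), 2 * y * (x^2 + y^2 - x)]"
    unfolding z by (simp only: triple_orient_simps)
      (intro conjI; simp add: algebra_simps power2_eq_square)
  have "\<forall>v \<in> set (triple_map orient ?ps). v \<noteq> 0"
    unfolding eq using assms sum_squares_pos[of y x] sum_squares_pos[of y "x - 1"] by simp
  then have gp: "0 \<notin> set (triple_map orient ?ps)" by blast
  have "(\<lambda>n. real (max_similar_copies_gp T n)) \<in> \<Omega>(\<lambda>n. real n powr (ln (9::nat) / ln (5::nat)))"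
  proof (rule list_lower_bound[OF gp _ _ _ _ _ _ T])
    show "\<forall>(i, j, k) \<in> set ?ts. i < length ?ps \<and> j < length ?ps \<and> k < length ?ps \<and> i \<noteq> j \<and>
      ?ps ! k = (1 - z) * ?ps ! i + z * ?ps ! j"
      by (simp add: algebra_simps)
  qed simp_all
  then show ?thesis by simp
qed

text \<open>The reflection \<open>p \<mapsto> z * z + z - 1 - p\<close> preserves the seed and
  groups the 12 entries of \<open>?ts\<close> into 6 pairs. The factors \<open>x\<close> and
  \<open>x - 1\<close> exclude right angles at 0 and 1.\<close>

lemma scalene_lower_bound_non_right:
  assumes z: "z = Complex x y" and "y \<noteq> 0" "2 * x - 1 \<noteq> 0" "x^2 + y^2 - 1 \<noteq> 0"
    "(x - 1)^2 + y^2 - 1 \<noteq> 0" "x^2 + y^2 - x \<noteq> 0" "x \<noteq> 0" "x - 1 \<noteq> 0"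
    and T: "similar_sets T {0, 1, z}"
  shows "(\<lambda>n. real (max_similar_copies_gp T n)) \<in> \<Omega>(\<lambda>n. real n powr (ln 20 / ln 8))"
proof -
  let ?ps = "[0, z - 1, z * (z - 1), z, z * z, 2 * z - 1, z * z + z - 1, z * z - 1]"
  let ?ts = "[(0,1,2), (0,3,4), (1,3,5), (1,5,6), (3,1,0), (3,5,4), (4,2,0), (4,7,2), (6,4,5), (6,7,1),
    (7,2,1), (7,4,6)]
    :: (nat \<times> nat \<times> nat) list"
  have eq: "triple_map orient ?ps =
    [
      y * ((x - 1)^2 + y^2), - y, y * ((x - 1)^2 + y^2 - 1), - y, y * ((x - 1)^2 + y^2 - 1),
      y * ((x - 1)^2 + y^2), - (y * (x^2 + y^2)), - (y * (x^2 + y^2)),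
      - (y * (2 * x^2 - 2 * x + 2 * y^2 + 1)), - (y * (2 * x^2 - 2 * x + 2 * y^2 + 1)),
      - (y * ((x - 1)^2 + y^2)), y * (x^2 + y^2), y, y * (x^2 + y^2 + 1), y * (x^2 + y^2 + 1),
      -2 * y * (x^2 + y^2 - x), - (y * ((x - 1)^2 + y^2 - 1)), 2 * y * x,
      y * (2 * x^2 - 2 * x + 2 * y^2 + 1), 2 * y * (x^2 - x + y^2 + 1), y * (x^2 + y^2 + 1),
      -2 * y * (x - 1), - (y * (x^2 + y^2 - 1)), - (y * (x^2 + y^2 - 1)),
      -2 * y * (x^2 + y^2 - x), - (y * ((x - 1)^2 + y^2)), y * (2 * x - 1), y, 2 * y * x,
      y * (2 * x - 1), - (y * (x^2 + y^2 - 1)), - (y * ((x - 1)^2 + y^2 - 1)), y * (2 * x - 1),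
      y * (x^2 + y^2), y * (x^2 + y^2), y * (x^2 + y^2), y * (x^2 + y^2),
      y * (x^2 - 2 * x + y^2 + 2), 2 * y * (x^2 - x + y^2 + 1), y * (x^2 - 2 * x + y^2 + 2),
      - (y * (x^2 + y^2 - 1)), y, y, y * (2 * x^2 - 2 * x + 2 * y^2 + 1),
      y * (x^2 - 2 * x + y^2 + 2), y, - (y * ((x - 1)^2 + y^2)), - (y * ((x - 1)^2 + y^2)),
      y * (2 * x - 1), y * ((x - 1)^2 + y^2), y * (x^2 - 2 * x + y^2 + 2), y * (x^2 + y^2 + 1),
      y * ((x - 1)^2 + y^2), -2 * y * (x - 1), y, y * (x^2 + y^2)]"
    unfolding z by (simp only: triple_orient_simps)
      (intro conjI; simp add: algebra_simps power2_eq_square)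
  \<comment> \<open>Completing squares: these are sums of squares centred at 0, 1 or 1/2 plus
    positive constants.\<close>
  have "0 < x^2 + y^2 + 1" "0 < x^2 - 2 * x + y^2 + 2" "0 < x^2 - x + y^2 + 1"
    "0 < 2 * x^2 - 2 * x + 2 * y^2 + 1"
    using sum_squares_pos[OF \<open>y \<noteq> 0\<close>, of x] sum_squares_pos[OF \<open>y \<noteq> 0\<close>, of "x - 1"]
      sum_squares_pos[OF \<open>y \<noteq> 0\<close>, of "x - 1 / 2"]
    by (simp_all add: power2_eq_square algebra_simps)
  then have "\<forall>v \<in> set (triple_map orient ?ps). v \<noteq> 0"
    unfolding eq using assms sum_squares_pos[of y x] sum_squares_pos[of y "x - 1"] by simp
  then have gp: "0 \<notin> set (triple_map orient ?ps)" by blast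
  have "(\<lambda>n. real (max_similar_copies_gp T n)) \<in> \<Omega>(\<lambda>n. real n powr (ln (20::nat) / ln (8::nat)))"
  proof (rule list_lower_bound[OF gp _ _ _ _ _ _ T])
    show "\<forall>(i, j, k) \<in> set ?ts. i < length ?ps \<and> j < length ?ps \<and> k < length ?ps \<and> i \<noteq> j \<and>
      ?ps ! k = (1 - z) * ?ps ! i + z * ?ps ! j"
      by (simp add: algebra_simps)
  qed simp_all
  then show ?thesis by simp
qed

text \<open>The unit circle is parametrised by \<open>t\<close>, the cotangent of half the apex angle; the seeds
  below are scaled so that their coordinates become polynomials in \<open>t\<close>.\<close>

lemma apex_relation_iff:
  fixes a b c :: complex and t :: real
  assumes "z * (of_real t - \<i>) = of_real t + \<i>"
  shows "c = (1 - z) * a + z * b \<longleftrightarrow>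
    (of_real t - \<i>) * c = (of_real t + \<i>) * b - 2 * \<i> * a"
proof -
  have "of_real t - \<i> \<noteq> 0" by (simp add: complex_eq_iff)
  then have "c = (1 - z) * a + z * b \<longleftrightarrow>
    (of_real t - \<i>) * c = (of_real t - \<i>) * ((1 - z) * a + z * b)" by simp
  also have "(of_real t - \<i>) * ((1 - z) * a + z * b) =
    (of_real t - \<i>) * a + (z * (of_real t - \<i>)) * (b - a)" by (simp add: algebra_simps)
  finally show ?thesis unfolding assms by (simp add: algebra_simps)
qed

text \<open>Divided by \<open>2 * (t^2 + 1)\<close>, the points are 0, 1, \<open>z\<close>,
  \<open>cnj z\<close>, \<open>1 + z\<close>, \<open>1 + cnj z\<close>, \<open>z / (1 - z)\<close>
  and the conjugate of the last. Conjugation exchanges the two base vertices of a copy. Besides 60,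
  90 and 120 degrees, the seed excludes 30 and 150 degrees (the quartic) and the apex angle with
  cosine 3/4 (\<open>t^2 = 7\<close>).\<close>

lemma isosceles_lower_bound_1:
  assumes z: "z * (of_real t - \<i>) = of_real t + \<i>" and "0 < t"
    "t^2 - 3 \<noteq> 0" "3 * t^2 - 1 \<noteq> 0" "t^2 - 1 \<noteq> 0" "t^2 - 7 \<noteq> 0" "t^4 - 14 * t^2 + 1 \<noteq> 0"
    and T: "similar_sets T {0, 1, z}"
  shows "(\<lambda>n. real (max_similar_copies_gp T n)) \<in> \<Omega>(\<lambda>n. real n powr (ln 17 / ln 8))"
proof -
  let ?ps = "[0, Complex (2 * (t^2 + 1)) 0, Complex (2 * (t^2 - 1)) (4 * t),
    Complex (2 * (t^2 - 1)) (- 4 * t), Complex (4 * t^2) (4 * t), Complex (4 * t^2) (- 4 * t),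
    Complex (- (t^2 + 1)) (t * (t^2 + 1)), Complex (- (t^2 + 1)) (- t * (t^2 + 1))]"
  let ?ts = "[(0,1,2), (0,3,1), (0,5,4), (4,2,1), (5,1,3), (6,0,2), (6,3,4), (7,3,0), (7,5,2)]
    :: (nat \<times> nat \<times> nat) list"
  have eq: "triple_map orient ?ps =
    [
      8 * t * (t^2 + 1), -8 * t * (t^2 + 1), 8 * t * (t^2 + 1), -8 * t * (t^2 + 1),
      2 * t * (t^2 + 1)^2, -2 * t * (t^2 + 1)^2, -16 * t * (t^2 - 1), -8 * t * (t^2 + 1),
      -8 * t * (3 * t^2 - 1), 2 * t * (t^2 + 1)^2, -2 * t * (t^2 + 1) * (t^2 - 3),
      8 * t * (3 * t^2 - 1), 8 * t * (t^2 + 1), 2 * t * (t^2 + 1) * (t^2 - 3),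
      -2 * t * (t^2 + 1)^2, -32 * t^3, 4 * t * (t^2 + 1)^2, -4 * t * (t^2 + 1) * (t^2 - 1),
      4 * t * (t^2 + 1) * (t^2 - 1), -4 * t * (t^2 + 1)^2, 2 * t * (t^2 + 1)^2, 32 * t,
      -8 * t * (t^2 + 1), -8 * t * (t^2 - 3), 8 * t * (t^2 + 1), 16 * t * (t^2 + 1),
      8 * t * (t^2 - 3), 8 * t * (t^2 + 1), -16 * t * (t^2 + 1), -8 * t * (t^2 + 1),
      -16 * t * (t^2 - 1), 2 * t * (t^2 + 1) * (t^2 + 5), -2 * t * (t^2 + 1) * (t^2 - 7),
      2 * t * (t^2 + 1) * (t^2 - 7), -2 * t * (t^2 + 1) * (t^2 + 5), 6 * t * (t^2 + 1)^2,
      16 * t * (t^2 + 1), 16 * t * (t^2 + 1), -8 * t * (3 * t^2 - 1), -8 * t * (3 * t^2 - 1),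
      -16 * t * (t^2 + 1), 2 * t * (t^2 + 1) * (t^2 - 3), -2 * t * (t^2 + 1) * (t^2 + 5),
      2 * t * (t^4 - 14 * t^2 + 1), -2 * t * (t^4 + 18 * t^2 + 1),
      2 * t * (t^2 + 1) * (3 * t^2 - 1), -16 * t * (t^2 + 1), 2 * t * (t^4 + 18 * t^2 + 1),
      -2 * t * (t^4 - 14 * t^2 + 1), 2 * t * (t^2 + 1) * (t^2 + 5),
      -2 * t * (t^2 + 1) * (t^2 - 3), 2 * t * (t^2 + 1) * (3 * t^2 - 1), -8 * t * (5 * t^2 + 1),
      -8 * t * (5 * t^2 + 1), 2 * t * (t^2 + 1) * (5 * t^2 + 1),
      2 * t * (t^2 + 1) * (5 * t^2 + 1)]"
    by (simp only: triple_orient_simps) (intro conjI; algebra)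
  have "0 < t^2 + 1" "0 < t^2 + 5" "0 < 5 * t^2 + 1" "0 < t^4 + 18 * t^2 + 1"
    by (simp_all add: add_nonneg_pos)
  then have "\<forall>v \<in> set (triple_map orient ?ps). v \<noteq> 0"
    unfolding eq using assms(2-7) by simp
  then have gp: "0 \<notin> set (triple_map orient ?ps)" by blast
  have "(\<lambda>n. real (max_similar_copies_gp T n)) \<in> \<Omega>(\<lambda>n. real n powr (ln (17::nat) / ln (8::nat)))"
  proof (rule list_lower_bound[OF gp _ _ _ _ _ _ T])
    show "\<forall>(i, j, k) \<in> set ?ts. i < length ?ps \<and> j < length ?ps \<and> k < length ?ps \<and> i \<noteq> j \<and>
      ?ps ! k = (1 - z) * ?ps ! i + z * ?ps ! j"
      unfolding apex_relation_iff[OF z]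
      by (simp add: complex_eq_iff) (intro conjI; algebra)
  qed simp_all
  then show ?thesis by simp
qed

text \<open>Covers the apex angles lost by the first seed other than 60, 90 and 120 degrees. The
  points are symmetric about the horizontal line through points 1 and 2, and the nine triples are
  permuted accordingly.\<close>

lemma isosceles_lower_bound_2:
  assumes z: "z * (of_real t - \<i>) = of_real t + \<i>" and "0 < t"
    "t^2 - 3 \<noteq> 0" "3 * t^2 - 1 \<noteq> 0" "t^2 - 1 \<noteq> 0" "t^4 + 10 * t^2 - 7 \<noteq> 0" "t^4 + 8 * t^2 - 1 \<noteq> 0"
    and T: "similar_sets T {0, 1, z}"
  shows "(\<lambda>n. real (max_similar_copies_gp T n)) \<in> \<Omega>(\<lambda>n. real n powr (ln 17 / ln 8))"
proof -
  let ?ps = "[0, Complex (- 2 * (t^2 + 1)) (- 2 * t * (t^2 + 1)),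
    Complex (2 * (t^2 + 1)) (- 2 * t * (t^2 + 1)), Complex (2 - 6 * t^2) (6 * t - 2 * t^3),
    Complex ((t^2 + 1)^2) 0, Complex 0 (- 4 * t * (t^2 + 1)),
    Complex (2 - 6 * t^2) (- 10 * t - 2 * t^3), Complex ((t^2 + 1)^2) (- 4 * t * (t^2 + 1))]"
  let ?ts = "[(0,1,2), (0,3,1), (2,3,6), (4,0,2), (4,3,5), (5,1,6), (5,2,1), (7,0,6), (7,2,5)]
    :: (nat \<times> nat \<times> nat) list"
  have eq: "triple_map orient ?ps =
    [
      8 * t * (t^2 + 1)^2, -8 * t * (t^2 + 1)^2, 2 * t * (t^2 + 1)^3, 8 * t * (t^2 + 1)^2,
      -8 * t * (t^2 + 1) * (t^2 - 3), 2 * t * (t^2 + 1)^2 * (t^2 + 5),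
      -16 * t * (t^2 + 1) * (t^2 - 1), 2 * t * (t^2 + 1)^3, -8 * t * (t^2 + 1)^2,
      -16 * t * (t^2 + 1)^2, 2 * t * (t^2 + 1)^2 * (t^2 - 3), 2 * t * (t^2 + 1)^2 * (t^2 - 3),
      8 * t * (t^2 + 1) * (3 * t^2 - 1), 32 * t * (3 * t^2 - 1),
      2 * t * (t^2 + 1) * (t^4 + 10 * t^2 - 7), -4 * t * (t^2 + 1)^3,
      -2 * t * (t^2 + 1)^2 * (t^2 + 5), -4 * t * (t^2 + 1)^3,
      -8 * t * (t^2 + 1) * (3 * t^2 - 1), 4 * t * (t^2 + 1)^3,
      2 * t * (t^2 + 1) * (t^4 + 18 * t^2 + 1), 32 * t * (t^2 + 1), 8 * t * (t^2 + 1)^2,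
      -8 * t * (t^2 + 1)^2, -32 * t * (t^2 + 1), -8 * t * (t^2 + 1)^2, -16 * t * (t^2 + 1)^2,
      8 * t * (t^2 + 1) * (t^2 - 3), 64 * t * (t^2 - 1), -32 * t * (t^2 + 1),
      -2 * t * (t^2 + 1)^2 * (t^2 + 5), -32 * t * (t^2 + 1), -4 * t * (t^2 + 1)^2 * (t^2 + 3),
      -8 * t * (t^2 + 1)^2, 2 * t * (t^2 + 1)^3, 16 * t * (t^2 + 1)^2,
      -8 * t * (t^2 + 1) * (3 * t^2 - 1), 16 * t * (t^2 + 1)^2, 128 * t^3, 8 * t * (t^2 + 1)^2,
      -2 * t * (t^2 + 1)^2 * (t^2 - 3), 8 * t * (t^2 + 1)^2, -4 * t * (t^2 + 1)^2 * (t^2 - 1),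
      -16 * t * (t^2 + 1) * (t^2 - 1), 2 * t * (t^2 + 1)^3, 8 * t * (t^2 + 1) * (3 * t^2 - 1),
      -2 * t * (t^2 + 1) * (t^4 + 18 * t^2 + 1), -16 * t * (t^4 + 8 * t^2 - 1),
      -4 * t * (t^2 + 1) * (t^4 + 8 * t^2 - 1), -32 * t * (3 * t^2 - 1),
      2 * t * (t^2 + 1)^2 * (t^2 + 5), 16 * t * (t^4 + 8 * t^2 - 1),
      -2 * t * (t^2 + 1) * (t^4 + 10 * t^2 - 7), 4 * t * (t^2 + 1)^3,
      4 * t * (t^2 + 1) * (t^4 + 8 * t^2 - 1), -2 * t * (t^2 + 1)^2 * (t^2 - 3)]"
    by (simp only: triple_orient_simps) (intro conjI; algebra)
  have "0 < t^2 + 1" "0 < t^2 + 3" "0 < t^2 + 5" "0 < t^4 + 18 * t^2 + 1"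
    by (simp_all add: add_nonneg_pos)
  then have "\<forall>v \<in> set (triple_map orient ?ps). v \<noteq> 0"
    unfolding eq using assms(2-7) by simp
  then have gp: "0 \<notin> set (triple_map orient ?ps)" by blast
  have "(\<lambda>n. real (max_similar_copies_gp T n)) \<in> \<Omega>(\<lambda>n. real n powr (ln (17::nat) / ln (8::nat)))"
  proof (rule list_lower_bound[OF gp _ _ _ _ _ _ T])
    show "\<forall>(i, j, k) \<in> set ?ts. i < length ?ps \<and> j < length ?ps \<and> k < length ?ps \<and> i \<noteq> j \<and>
      ?ps ! k = (1 - z) * ?ps ! i + z * ?ps ! j"
      unfolding apex_relation_iff[OF z]
      by (simp add: complex_eq_iff) (intro conjI; algebra)
  qed simp_all
  then show ?thesis by simp
qed

section \<open>The lower bounds\<close>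

lemma powr_bigomega_mono:
  assumes "b \<le> a"
  shows "(\<lambda>n::nat. real n powr a) \<in> \<Omega>(\<lambda>n. real n powr b)"
proof (rule landau_omega.bigI[of 1])
  show "\<forall>\<^sub>F n in sequentially. norm (real n powr a) \<ge> 1 * norm (real n powr b)"
    using eventually_ge_at_top[of 1] by eventually_elim (use assms in \<open>auto intro: powr_mono\<close>)
qed simp

lemma bigomega_powr_weaken:
  assumes "f \<in> \<Omega>(\<lambda>n::nat. real n powr a)" "b \<le> a"
  shows "f \<in> \<Omega>(\<lambda>n. real n powr b)"
  using landau_omega.big_trans[OF assms(1) powr_bigomega_mono[OF assms(2)]] .

lemma ln_quotient_ge:
  fixes M N :: real
  assumes "1 < N" "1 < M" "0 < q" "N ^ p \<le> M ^ q"
  shows "real p / real q \<le> ln M / ln N"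
proof -
  have "ln (N ^ p) \<le> ln (M ^ q)" using assms by (subst ln_le_cancel_iff) auto
  then have "real p * ln N \<le> real q * ln M" using assms by (simp add: ln_realpow)
  then show ?thesis using assms by (simp add: divide_simps mult.commute)
qed

lemma ln_quotient_le:
  fixes M N :: real
  assumes "1 < N" "1 < M" "0 < q" "M ^ q \<le> N ^ p"
  shows "ln M / ln N \<le> real p / real q"
proof -
  have "ln (M ^ q) \<le> ln (N ^ p)" using assms by (subst ln_le_cancel_iff) auto
  then have "real q * ln M \<le> real p * ln N" using assms by (simp add: ln_realpow)
  then show ?thesis using assms by (simp add: divide_simps mult.commute)
qed

text \<open>The rational \<open>p / q\<close> separates the two quotients, so that only integer
  powers have to be compared.\<close>

lemma ln_quotient_mono:
  fixes M N M' N' :: real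
  assumes "1 < N" "1 < M" "1 < N'" "1 < M'" "0 < q" "M ^ q \<le> N ^ p" "N' ^ p \<le> M' ^ q"
  shows "ln M / ln N \<le> ln M' / ln N'"
  using ln_quotient_le[of N M q p] ln_quotient_ge[of N' M' q p] assms by linarith

section \<open>Normal forms and isosceles triangles\<close>

lemma similar_sets_triangle:
  assumes "a \<noteq> b"
  shows "similar_sets {a, b, c} {0, 1, (c - a) / (b - a)}"
proof -
  have "{0, 1, (c - a) / (b - a)} = (\<lambda>u. 1 / (b - a) * u + - a / (b - a)) ` {a, b, c}"
    using assms by (auto simp: diff_divide_distrib[symmetric])
  moreover have "1 / (b - a) \<noteq> 0" using assms by simp
  ultimately show ?thesis unfolding similar_sets_def by blast
qed

lemma triangle_distinct:
  assumes "triangle {a, b, c}"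
  shows "a \<noteq> b" "b \<noteq> c" "a \<noteq> c"
  using assms by (auto simp: triangle_def card_insert_if split: if_splits)

lemma triangle_Im_nonzero:
  assumes "triangle {a, b, c}"
  shows "Im ((c - a) / (b - a)) \<noteq> 0"
  using assms by (simp add: triangle_def collinear_iff_Im)

text \<open>Exchanging \<open>b\<close> and \<open>c\<close> inverts the unimodular number
  \<open>w\<close>, that is, conjugates it; one of the two choices lies in the upper half-plane. The
  norm of \<open>z - 1\<close> records the ratio of base to leg.\<close>

lemma isosceles_normal_form:
  assumes T: "triangle {a, b, c}" and "dist a b = dist a c"
  obtains z where "0 < Im z" "norm z = 1" "norm (z - 1) = dist b c / dist a b"
    "similar_sets {a, b, c} {0, 1, z}"
proof -
  note d = triangle_distinct[OF T]
  define w where "w = (c - a) / (b - a)"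
  have w: "norm w = 1" "Im w \<noteq> 0"
    using assms d triangle_Im_nonzero[OF T] by (auto simp: w_def norm_divide dist_norm norm_minus_commute)
  have w1: "w - 1 = (c - b) / (b - a)" "inverse w - 1 = (b - c) / (c - a)"
    using d by (auto simp: w_def field_simps)
  have sim: "similar_sets {a, b, c} {0, 1, w}" "similar_sets {a, b, c} {0, 1, inverse w}"
    using similar_sets_triangle[of a b c] similar_sets_triangle[of a c b] d
    by (auto simp: w_def insert_commute)
  show ?thesis
  proof (cases "0 < Im w")
    case True
    then show ?thesis
      using that[of w] w sim(1) w1(1) by (simp add: norm_divide dist_norm norm_minus_commute)
  next
    case False
    have "inverse w = cnj w"
      using w by (simp add: inverse_eq_divide divide_conv_cnj)
    then have "0 < Im (inverse w)" using False w by simp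
    then show ?thesis
      using that[of "inverse w"] w sim(2) w1(2) assms(2)
      by (simp add: norm_divide norm_inverse dist_norm norm_minus_commute)
  qed
qed

lemma equilateral_apex:
  assumes "0 < Im z" "norm z = 1" "norm (z - 1) = 1"
  shows "z = Complex (1/2) (sqrt 3 / 2)"
proof -
  have 1: "(Re z)\<^sup>2 + (Im z)\<^sup>2 = 1" "(Re z - 1)\<^sup>2 + (Im z)\<^sup>2 = 1"
    using assms by (auto simp: cmod_def)
  then have "Re z = 1/2" by (simp add: power2_eq_square algebra_simps)
  moreover have "Im z = sqrt (3/4)"
    using 1(1) assms(1) calculation by (intro real_sqrt_unique[symmetric]) (auto simp: power2_eq_square)
  ultimately show ?thesis by (simp add: complex_eq_iff real_sqrt_divide)
qed

lemma isosceles_copies: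
  assumes "0 < Im z" "norm z = 1" and T: "similar_sets T {0, 1, z}"
  shows "(\<lambda>n. real (max_similar_copies_gp T n)) \<in> \<Omega>(\<lambda>n. real n powr (ln 17 / ln 8))"
proof -
  define x y where "x = Re z" and "y = Im z"
  have y: "0 < y" and xy: "x^2 + y^2 = 1"
    using assms by (auto simp: x_def y_def cmod_def)
  \<comment> \<open>The cotangent of half the apex angle, as \<open>x\<close> and \<open>y\<close>
    are its cosine and sine.\<close>
  define t where "t = (1 + x) / y"
  have "\<bar>x\<bar> \<noteq> 1" using y xy by (auto simp: abs_if split: if_splits)
  moreover have "\<bar>x\<bar> \<le> 1" using xy y by (metis abs_square_le_1 le_add_same_cancel1 zero_le_power2)
  ultimately have "0 < t" using y by (simp add: t_def)
  have eq1: "y * t = 1 + x" using y by (simp add: t_def)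
  have "y * (x * t + y) = x * (y * t) + y^2" by (simp add: algebra_simps power2_eq_square)
  also have "\<dots> = y * t" using xy unfolding eq1 by (simp add: algebra_simps power2_eq_square)
  finally have eq2: "x * t + y = t" using y by simp
  have zt: "z * (of_real t - \<i>) = of_real t + \<i>"
    using eq1 eq2 by (simp add: complex_eq_iff x_def y_def algebra_simps)
  have x: "x * (t^2 + 1) = t^2 - 1" and y': "y * (t^2 + 1) = 2 * t"
    using eq1 eq2 by algebra+
  \<comment> \<open>The first three cases are the apex angles 60, 120 and 90 degrees; then come the
    first seed and, where it degenerates, the second.\<close>
  consider "t^2 = 3" | "3 * t^2 = 1" | "t^2 = 1"
    | "t^2 \<noteq> 3" "3 * t^2 \<noteq> 1" "t^2 \<noteq> 1" "t^2 - 7 \<noteq> 0" "t^4 - 14 * t^2 + 1 \<noteq> 0"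
    | "t^2 \<noteq> 3" "3 * t^2 \<noteq> 1" "t^2 \<noteq> 1" "t^2 = 7 \<or> t^4 - 14 * t^2 + 1 = 0"
    by fastforce
  then show ?thesis
  proof cases
    case 1
    then have "t = sqrt 3" using \<open>0 < t\<close> real_sqrt_unique[of t 3] by simp
    then have "z = Complex (1/2) (sqrt 3 / 2)" using 1 x y' by (simp add: complex_eq_iff x_def y_def)
    then have "(\<lambda>n. real (max_similar_copies_gp T n)) \<in> \<Omega>(\<lambda>n. real n powr (ln 102 / ln 15))"
      using equilateral_lower_bound T by blast
    then show ?thesis
      by (rule bigomega_powr_weaken)
        (rule ln_quotient_mono[where q = 2 and p = 3], simp_all)
  next
    case 2
    then have "3 * t = sqrt 3" using \<open>0 < t\<close> real_sqrt_unique[of "3 * t" 3]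
      by (simp add: power2_eq_square)
    have t2: "t^2 = 1 / 3" using 2 by simp
    have "x = - 1 / 2" using x unfolding t2 by simp
    moreover have "y = sqrt 3 / 2" using y' \<open>3 * t = sqrt 3\<close> unfolding t2 by simp
    ultimately have "z = Complex (-1/2) (sqrt 3 / 2)" by (simp add: complex_eq_iff x_def y_def)
    then have "(\<lambda>n. real (max_similar_copies_gp T n)) \<in> \<Omega>(\<lambda>n. real n powr (ln 12 / ln 6))"
      using hexagon_lower_bound T by blast
    then show ?thesis
      by (rule bigomega_powr_weaken)
        (rule ln_quotient_mono[where q = 8 and p = 11], simp_all)
  next
    case 3
    then have "t = 1" using \<open>0 < t\<close> by (simp add: power2_eq_1_iff)
    then have "z = \<i>" using x y' by (simp add: complex_eq_iff x_def y_def)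
    then have "(\<lambda>n. real (max_similar_copies_gp T n)) \<in> \<Omega>(\<lambda>n. real n powr (ln 8 / ln 4))"
      using square_lower_bound T by blast
    then show ?thesis
      by (rule bigomega_powr_weaken)
        (rule ln_quotient_mono[where q = 2 and p = 3], simp_all)
  next
    case 4
    show ?thesis
      by (rule isosceles_lower_bound_1[OF zt \<open>0 < t\<close> _ _ _ 4(4,5) T]) (use 4(1-3) in simp_all)
  next
    case 5
    have t4: "t^4 = t^2 * t^2" by (simp flip: power_add)
    have nz: "t^4 + 10 * t^2 - 7 \<noteq> 0" "t^4 + 8 * t^2 - 1 \<noteq> 0"
      using 5(4)
    proof safe
      assume t2: "t^2 = 7"
      have "t^4 = 49" using t4 unfolding t2 by simp
      then show "t^4 + 10 * t^2 - 7 = 0 \<Longrightarrow> False" "t^4 + 8 * t^2 - 1 = 0 \<Longrightarrow> False"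
        using t2 by simp_all
    next
      assume *: "t^4 - 14 * t^2 + 1 = 0"
      \<comment> \<open>The quartics of the two seeds have no admissible common root: subtraction
        gives \<open>t^2 = 1/3\<close>, already excluded, and below \<open>t^2 = 1/11\<close>, which
        fails the first quartic.\<close>
      show False if "t^4 + 10 * t^2 - 7 = 0" using that * 5(2) by linarith
      show False if "t^4 + 8 * t^2 - 1 = 0"
      proof -
        have t2: "t^2 = 1 / 11" using that * by linarith
        have "t^4 = 1 / 121" using t4 unfolding t2 by simp
        then show False using * t2 by simp
      qed
    qed
    show ?thesis
      by (rule isosceles_lower_bound_2[OF zt \<open>0 < t\<close> _ _ _ nz T]) (use 5(1-3) in simp_all)
  qed
qed

section \<open>Scalene triangles\<close>

lemma scalene_dist_neq:
  assumes "scalene T" "p \<in> T" "q \<in> T" "r \<in> T" "p \<noteq> q" "q \<noteq> r" "p \<noteq> r"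
  shows "dist p q \<noteq> dist q r"
  using assms unfolding scalene_def by (auto simp: dist_commute)

text \<open>Similarities scale all distances by one factor, so \<open>{0, 1, z}\<close> has three
  different side lengths; each conclusion compares two of them.\<close>

lemma scalene_normal_form:
  assumes "scalene T" "similar_sets T {0, 1, Complex x y}" and y: "y \<noteq> 0"
  shows "2 * x - 1 \<noteq> 0" "x^2 + y^2 - 1 \<noteq> 0" "(x - 1)^2 + y^2 - 1 \<noteq> 0"
proof -
  let ?z = "Complex x y"
  obtain \<alpha> \<beta> where \<alpha>: "\<alpha> \<noteq> 0" and img: "{0, 1, ?z} = (\<lambda>a. \<alpha> * a + \<beta>) ` T"
    using assms(2) by (auto simp: similar_sets_def)
  have neq: "dist u v \<noteq> dist v w" if uvw: "u \<in> {0, 1, ?z}" "v \<in> {0, 1, ?z}" "w \<in> {0, 1, ?z}"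
    "u \<noteq> v" "v \<noteq> w" "u \<noteq> w" for u v w
  proof -
    obtain p q r where p: "p \<in> T" "q \<in> T" "r \<in> T"
      "u = \<alpha> * p + \<beta>" "v = \<alpha> * q + \<beta>" "w = \<alpha> * r + \<beta>"
      using uvw(1-3) unfolding img by blast
    then have "dist p q \<noteq> dist q r" using assms(1) uvw(4-6) by (intro scalene_dist_neq) auto
    moreover have "dist u v = norm \<alpha> * dist p q" "dist v w = norm \<alpha> * dist q r"
      using p by (simp_all add: dist_norm right_diff_distrib[symmetric] norm_mult)
    ultimately show ?thesis using \<alpha> by simp
  qed
  have ne: "0 \<noteq> ?z" "1 \<noteq> ?z" using y by (auto simp: complex_eq_iff)
  have d: "dist ?z 0 = sqrt (x^2 + y^2)" "dist 0 ?z = sqrt (x^2 + y^2)"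
    "dist 1 ?z = sqrt ((x - 1)^2 + y^2)" "dist ?z 1 = sqrt ((x - 1)^2 + y^2)"
    by (simp_all add: dist_norm cmod_def power2_commute)
  show "2 * x - 1 \<noteq> 0"
    using neq[of 0 ?z 1, unfolded d] ne by (auto simp: power2_eq_square algebra_simps)
  show "x^2 + y^2 - 1 \<noteq> 0"
    using neq[of 1 0 ?z, unfolded d] ne by auto
  show "(x - 1)^2 + y^2 - 1 \<noteq> 0"
    using neq[of 0 1 ?z, unfolded d] ne by auto
qed

text \<open>The five-point seed is obstructed only by a right angle at the third vertex. In that
  case the vertices are relabelled so that the right angle sits at the vertex sent to 0.\<close>

lemma scalene_copies:
  assumes "scalene {a, b, c}"
  shows "(\<lambda>n. real (max_similar_copies_gp {a, b, c} n)) \<in> \<Omega>(\<lambda>n. real n powr (ln 9 / ln 5))"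
proof -
  have *: ?thesis if "{a, b, c} = {p, q, r}" "Re ((r - p) / (q - p)) = u" "Im ((r - p) / (q - p)) = v"
    "u^2 + v^2 - u \<noteq> 0" for p q r u v
  proof -
    have T: "scalene {p, q, r}" "triangle {p, q, r}" using assms that(1) by (auto simp: scalene_def)
    have z: "(r - p) / (q - p) = Complex u v" using that by (simp add: complex_eq_iff)
    have "v \<noteq> 0" using triangle_Im_nonzero[OF T(2)] z by simp
    have sim: "similar_sets {p, q, r} {0, 1, Complex u v}"
      using similar_sets_triangle[of p q r] triangle_distinct[OF T(2)] z by simp
    show ?thesis
      unfolding that(1)
      using scalene_lower_bound[OF refl \<open>v \<noteq> 0\<close> _ _ _ _ sim] that(4)
        scalene_normal_form[OF T(1) sim \<open>v \<noteq> 0\<close>] by blast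
  qed
  have tri: "triangle {a, b, c}" using assms by (simp add: scalene_def)
  note d = triangle_distinct[OF tri]
  define z where "z = (c - a) / (b - a)"
  define w where "w = (a - c) / (b - c)"
  have ca: "c - a = z * (b - a)" using d by (simp add: z_def)
  then have z1: "z \<noteq> 1" using d by auto
  have "b - c = (1 - z) * (b - a)" using ca by (simp add: algebra_simps)
  moreover have "a - c = - z * (b - a)" using ca by (simp add: algebra_simps)
  ultimately have w: "w * (1 - z) = - z" using d z1 by (simp add: w_def)
  show ?thesis
  proof (cases "(Re z)^2 + (Im z)^2 - Re z = 0")
    case False
    then show ?thesis using *[OF refl refl refl] by (simp add: z_def)
  next
    case True
    have "w = - z / (1 - z)" using w z1 by (simp add: field_simps)
    then have "Re w = 0"
      using True by (simp add: Re_divide power2_eq_square algebra_simps)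
    moreover have "Im w \<noteq> 0"
      unfolding w_def using tri by (intro triangle_Im_nonzero) (simp add: insert_commute)
    \<comment> \<open>With \<open>u = 0\<close> the remaining condition reduces to
      \<open>v^2 \<noteq> 0\<close>.\<close>
    ultimately show ?thesis
      by (intro *[of c b a]) (auto simp: w_def)
  qed
qed

text \<open>The three parts correspond to a right angle of \<open>{0, 1, z}\<close> at 0, at 1 and,
  by Thales, at \<open>z\<close>.\<close>

definition right_apexes :: "complex set" where
  "right_apexes = {z. Re z = 0} \<union> {z. Re z = 1} \<union> sphere (1/2) (1/2)"

lemma right_apexes_null: "right_apexes \<in> null_sets lebesgue"
proof -
  have "negligible {z::complex. Re z = r}" for r
    using negligible_standard_hyperplane[of "1::complex" r] by (simp add: Basis_complex_def)
  then show ?thesis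
    unfolding right_apexes_def negligible_iff_null_sets[symmetric]
    by (intro negligible_Un negligible_sphere) auto
qed

lemma scalene_copies_non_right:
  assumes "scalene T" "similar_sets T {0, 1, z}" "z \<notin> \<real>" "z \<notin> right_apexes"
  shows "(\<lambda>n. real (max_similar_copies_gp T n)) \<in> \<Omega>(\<lambda>n. real n powr (ln 20 / ln 8))"
proof -
  define x y where "x = Re z" and "y = Im z"
  have z: "z = Complex x y" by (simp add: x_def y_def)
  have y: "y \<noteq> 0" using assms by (simp add: y_def complex_is_Real_iff)
  have x: "x \<noteq> 0" "x - 1 \<noteq> 0" using assms by (auto simp: right_apexes_def x_def)
  have "x^2 + y^2 - x \<noteq> 0"
  proof
    assume "x^2 + y^2 - x = 0"
    then have "(1/2 - x)^2 + y^2 = (1/2)^2" by (simp add: power2_eq_square algebra_simps)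
    then have "dist (1/2) z = 1/2" by (simp add: dist_norm cmod_def z real_sqrt_unique)
    then show False using assms by (simp add: right_apexes_def)
  qed
  then show ?thesis
    using scalene_lower_bound_non_right[OF z y _ _ _ _ x] scalene_normal_form[of T x y] assms y
    by (simp add: z)
qed

theorem theorem3:
  shows
    "(\<forall>T. equilateral T \<longrightarrow>
        (\<lambda>n. real (max_similar_copies_gp T n)) \<in> \<Omega>(\<lambda>n. real n powr (ln 102 / ln 15)))
     \<and> (\<lambda>n::nat. real n powr (ln 102 / ln 15)) \<in> \<Omega>(\<lambda>n. real n powr 1.707)
     \<and> (\<forall>T. isosceles T \<longrightarrow>
        (\<lambda>n. real (max_similar_copies_gp T n)) \<in> \<Omega>(\<lambda>n. real n powr (ln 17 / ln 8)))
     \<and> (\<lambda>n::nat. real n powr (ln 17 / ln 8)) \<in> \<Omega>(\<lambda>n. real n powr 1.362)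
     \<and> (\<forall>T. scalene T \<longrightarrow>
        (\<lambda>n. real (max_similar_copies_gp T n)) \<in> \<Omega>(\<lambda>n. real n powr (ln 9 / ln 5)))
     \<and> (\<lambda>n::nat. real n powr (ln 9 / ln 5)) \<in> \<Omega>(\<lambda>n. real n powr 1.365)
     \<and> (\<exists>E \<in> null_sets (lebesgue :: complex measure).
        \<forall>T. \<forall>z \<in> - \<real> - E. scalene T \<and> similar_sets T {0, 1, z} \<longrightarrow>
          (\<lambda>n. real (max_similar_copies_gp T n)) \<in> \<Omega>(\<lambda>n. real n powr (ln 40 / ln 14)))
     \<and> (\<lambda>n::nat. real n powr (ln 40 / ln 14)) \<in> \<Omega>(\<lambda>n. real n powr 1.397)"
proof (intro conjI allI impI bexI[OF _ right_apexes_null] ballI)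
  fix T assume "equilateral T"
  then obtain a b c where T: "T = {a, b, c}" "dist a b = dist b c" "dist b c = dist c a"
    and tri: "triangle {a, b, c}" by (auto simp: equilateral_def)
  then obtain z where z: "0 < Im z" "norm z = 1" "norm (z - 1) = dist b c / dist a b"
    "similar_sets {a, b, c} {0, 1, z}"
    using isosceles_normal_form[OF tri] by (metis dist_commute)
  then have "norm (z - 1) = 1" using T triangle_distinct[OF tri] by simp
  then show "(\<lambda>n. real (max_similar_copies_gp T n)) \<in> \<Omega>(\<lambda>n. real n powr (ln 102 / ln 15))"
    using equilateral_lower_bound equilateral_apex z T by blast
next
  fix T assume "isosceles T"
  then obtain a b c where T: "T = {a, b, c}" "dist a b = dist a c"
    and tri: "triangle {a, b, c}" by (auto simp: isosceles_def)
  then show "(\<lambda>n. real (max_similar_copies_gp T n)) \<in> \<Omega>(\<lambda>n. real n powr (ln 17 / ln 8))"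
    using isosceles_normal_form[OF tri] isosceles_copies by metis
next
  fix T assume "scalene T"
  then show "(\<lambda>n. real (max_similar_copies_gp T n)) \<in> \<Omega>(\<lambda>n. real n powr (ln 9 / ln 5))"
    using scalene_copies by (metis scalene_def)
next
  fix T z assume "z \<in> - \<real> - right_apexes" "scalene T \<and> similar_sets T {0, 1, z}"
  then have "(\<lambda>n. real (max_similar_copies_gp T n)) \<in> \<Omega>(\<lambda>n. real n powr (ln 20 / ln 8))"
    using scalene_copies_non_right by blast
  \<comment> \<open>The separating rational is 10/7: \<open>40^7 \<le> 14^10\<close> and
    \<open>8^10 \<le> 20^7\<close>.\<close>
  then show "(\<lambda>n. real (max_similar_copies_gp T n)) \<in> \<Omega>(\<lambda>n. real n powr (ln 40 / ln 14))"
    by (rule bigomega_powr_weaken)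
      (rule ln_quotient_mono[where q = 7 and p = 10], simp_all)
\<comment> \<open>The fractions 70/41, 79/58, 86/63 and 95/68 lie between the decimal exponents and
  the quotients of logarithms.\<close>
qed (rule powr_bigomega_mono,
  use ln_quotient_ge[of 15 102 41 70] ln_quotient_ge[of 8 17 58 79]
    ln_quotient_ge[of 5 9 63 86] ln_quotient_ge[of 14 40 68 95] in simp)+

end
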